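(* For all integers $n\geq 1$ and $p\geq 0$, $$\left(\sum_{i = 0}^{p+1} \binom{p+1}{i} B_{n+i}\right)\left(\sum_{i = 0}^{p} \binom{p}{i} B_{n+i}\right)<\left(\sum_{i = 0}^{p+1} \binom{p+1}{i} B_{n+i-1}\right)\left(\sum_{i = 0}^{p} \binom{p}{i} B_{n+i+1}\right).$$
   Context: For $n\ge 0$, $B_n$ denotes the $n$-th Bell number, i.e. the number of partitions of a set with $n$ elements ($B_0=B_1=1$, $B_2=2$, $B_3=5$, $B_4=15$, ...). *)

theory Defs
  imports Complex_Main "HOL-Library.Disjoint_Sets"
begin

definition bell :: "nat \<Rightarrow> nat" where
  "bell n = card {P. partition_on {..<n} P}"

end

theory Submission
  imports Defs
begin

text \<open>
  Grouping the \<open>k ^ n\<close> maps from an \<open>n\<close>-set to a \<open>k\<close>-set by their kernel, a partition \<open>P\<close>,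
  writes \<open>k ^ n\<close> as the sum over \<open>P\<close> of the number of injections \<open>P \<rightarrow> {..<k}\<close>. Dividing by \<open>k!\<close>
  and summing over \<open>k\<close>, each partition contributes \<open>e\<close>: this is Dobinski's formula, so that the Bell
  numbers are the moments of the Poisson distribution with parameter 1. With the positive weights
  \<open>w k = k ^ (n - 1) * (k + 1) ^ p / k!\<close> and \<open>a, b, c\<close> the sums of \<open>w k\<close>, \<open>k * w k\<close>, \<open>k\<^sup>2 * w k\<close>,
  the claim becomes \<open>(c + b) * b < (a + b) * c\<close>, that is, the strict Cauchy-Schwarz inequality
  \<open>b\<^sup>2 < a * c\<close>.
\<close>

definition kernel :: "'a set \<Rightarrow> ('a \<Rightarrow> 'b) \<Rightarrow> 'a set set" where
  "kernel A f = (\<lambda>y. {x \<in> A. f x = y}) ` f ` A"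

lemma partition_on_kernel: "partition_on A (kernel A f)"
  by (rule partition_onI) (auto simp: kernel_def disjnt_def)

text \<open>Here \<open>b\<close> sends a point to its block. Two partitions agree when their
  equivalence relations do, and this pointwise form makes counting the maps with a given kernel
  easy.\<close>

lemma kernel_eq_iff:
  assumes P: "partition_on A P"
    and b: "\<And>x. x \<in> A \<Longrightarrow> b x \<in> P \<and> x \<in> b x"
  shows "kernel A f = P \<longleftrightarrow> (\<forall>x\<in>A. \<forall>y\<in>A. f x = f y \<longleftrightarrow> b x = b y)"
proof -
  have uniq: "p = b x" if "p \<in> P" "x \<in> p" for p x
    using that b[of x] P by (auto simp: partition_on_def disjoint_def)
  have ker: "kernel A f = (\<lambda>x. {y \<in> A. f y = f x}) ` A"
    by (auto simp: kernel_def)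
  have block: "b x = {y \<in> A. b y = b x}" if "x \<in> A" for x
    using that b uniq P by (fastforce simp: partition_on_def)
  have P_eq: "P = b ` A"
  proof
    show "P \<subseteq> b ` A"
    proof
      fix p assume p: "p \<in> P"
      then obtain x where x: "x \<in> p"
        using P by (metis all_not_in_conv partition_onD3)
      then have "x \<in> A"
        using p P by (auto simp: partition_on_def)
      then show "p \<in> b ` A"
        using uniq[OF p x] by blast
    qed
  qed (use b in blast)
  show ?thesis
  proof
    assume eq: "kernel A f = P"
    have fib: "b x = {y \<in> A. f y = f x}" if "x \<in> A" for x
      using uniq[of "{y \<in> A. f y = f x}" x] eq ker that by auto
    show "\<forall>x\<in>A. \<forall>y\<in>A. f x = f y \<longleftrightarrow> b x = b y"
    proof (intro ballI iffI)
      fix x y assume xy: "x \<in> A" "y \<in> A"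
      show "b x = b y" if "f x = f y"
        using that by (simp add: fib xy)
      show "f x = f y" if "b x = b y"
      proof -
        have "y \<in> b x"
          using that b[OF xy(2)] by simp
        then show ?thesis
          by (simp add: fib[OF xy(1)])
      qed
    qed
  next
    assume "\<forall>x\<in>A. \<forall>y\<in>A. f x = f y \<longleftrightarrow> b x = b y"
    then have "{y \<in> A. f y = f x} = b x" if "x \<in> A" for x
      using that block[of x] by auto
    then show "kernel A f = P"
      unfolding ker P_eq by (rule image_cong[OF refl])
  qed
qed

text \<open>A map with kernel \<open>P\<close> is constant on blocks and separates them, so it
  factors through the block map \<open>b\<close> as an injection on \<open>P\<close>. Composing with
  a choice \<open>c\<close> of representatives recovers that injection.\<close>

lemma card_kernel_eq:
  assumes P: "partition_on A P"
  shows "card {f \<in> A \<rightarrow>\<^sub>E B. kernel A f = P} = card {g \<in> P \<rightarrow>\<^sub>E B. inj_on g P}"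
proof -
  have "\<forall>x\<in>A. \<exists>p. p \<in> P \<and> x \<in> p"
    using P by (auto simp: partition_on_def)
  then obtain b where b: "\<And>x. x \<in> A \<Longrightarrow> b x \<in> P \<and> x \<in> b x"
    by metis
  have "\<forall>p\<in>P. \<exists>x. x \<in> p"
    using P by (metis all_not_in_conv partition_onD3)
  then obtain c where c: "\<And>p. p \<in> P \<Longrightarrow> c p \<in> p"
    by metis
  have cA: "c p \<in> A" if "p \<in> P" for p
    using c[OF that] that P by (auto simp: partition_on_def)
  have bc: "b (c p) = p" if "p \<in> P" for p
    using c[OF that] b[OF cA[OF that]] that P by (auto simp: partition_on_def disjoint_def)
  define F where "F = {f \<in> A \<rightarrow>\<^sub>E B. \<forall>x\<in>A. \<forall>y\<in>A. f x = f y \<longleftrightarrow> b x = b y}"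
  have "{f \<in> A \<rightarrow>\<^sub>E B. kernel A f = P} = F"
    unfolding F_def using kernel_eq_iff[OF P b] by blast
  moreover have "bij_betw (\<lambda>f. restrict (f \<circ> c) P) F {g \<in> P \<rightarrow>\<^sub>E B. inj_on g P}"
  proof (rule bij_betw_byWitness[where f' = "\<lambda>g. restrict (g \<circ> b) A"])
    show "\<forall>f\<in>F. restrict (restrict (f \<circ> c) P \<circ> b) A = f"
    proof
      fix f assume f: "f \<in> F"
      show "restrict (restrict (f \<circ> c) P \<circ> b) A = f"
      proof (rule extensionalityI[where A = A])
        show "f \<in> extensional A"
          using f by (simp add: F_def PiE_def)
        fix x assume x: "x \<in> A"
        \<comment> \<open>By \<open>bc\<close>, the points \<open>c (b x)\<close> and
          \<open>x\<close> share a block.\<close>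
        then have "f (c (b x)) = f x"
          using f b[OF x] cA bc unfolding F_def by blast
        then show "restrict (restrict (f \<circ> c) P \<circ> b) A x = f x"
          using x b by simp
      qed simp
    qed
    show "\<forall>g\<in>{g \<in> P \<rightarrow>\<^sub>E B. inj_on g P}. restrict (restrict (g \<circ> b) A \<circ> c) P = g"
      using cA bc by (auto intro!: extensionalityI[where A = P] simp: PiE_def)
    show "(\<lambda>f. restrict (f \<circ> c) P) ` F \<subseteq> {g \<in> P \<rightarrow>\<^sub>E B. inj_on g P}"
    proof (rule image_subsetI)
      fix f assume f: "f \<in> F"
      have "p = q" if "p \<in> P" "q \<in> P" "f (c p) = f (c q)" for p q
        using f that cA bc unfolding F_def by (metis (mono_tags, lifting) mem_Collect_eq)
      moreover have "f (c p) \<in> B" if "p \<in> P" for p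
        using f cA[OF that] unfolding F_def by blast
      ultimately show "restrict (f \<circ> c) P \<in> {g \<in> P \<rightarrow>\<^sub>E B. inj_on g P}"
        by (auto simp: inj_on_def)
    qed
    show "(\<lambda>g. restrict (g \<circ> b) A) ` {g \<in> P \<rightarrow>\<^sub>E B. inj_on g P} \<subseteq> F"
      using b by (auto simp: F_def inj_on_eq_iff)
  qed
  ultimately show ?thesis
    by (simp add: bij_betw_same_card)
qed

lemma card_funcset_eq_sum_partitions:
  assumes "finite A" "finite B"
  shows "card B ^ card A = (\<Sum>P | partition_on A P. card {g \<in> P \<rightarrow>\<^sub>E B. inj_on g P})"
proof -
  have fin: "finite (A \<rightarrow>\<^sub>E B)"
    using assms by (intro finite_PiE) auto
  have "(\<Sum>P | partition_on A P. \<Sum>f | f \<in> A \<rightarrow>\<^sub>E B \<and> kernel A f = P. 1)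
      = (\<Sum>f \<in> A \<rightarrow>\<^sub>E B. 1 :: nat)"
    using fin finitely_many_partition_on[OF assms(1)] partition_on_kernel
    by (intro sum.group) auto
  then have "card (A \<rightarrow>\<^sub>E B) = (\<Sum>P | partition_on A P. card {f \<in> A \<rightarrow>\<^sub>E B. kernel A f = P})"
    by simp
  then show ?thesis
    using card_kernel_eq[of A _ B] by (simp add: card_funcsetE[OF assms(1)])
qed

text \<open>The count is the falling factorial k!/(k-m)! with m the size of \<open>P\<close>, and 0
  for k < m. Dividing by k! leaves the exponential series at 1, delayed by m terms.\<close>

lemma sums_card_injections:
  assumes "finite P"
  shows "(\<lambda>k. real (card {g \<in> P \<rightarrow>\<^sub>E {..<k}. inj_on g P}) / fact k) sums exp 1"
proof -
  define m where "m = card P"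
  have card: "card {g \<in> P \<rightarrow>\<^sub>E {..<k}. inj_on g P} = (\<Prod>i = 0..<m. k - i)" for k
    using card_inj_on_subset_funcset[OF assms _ subset_refl, of "{..<k}"] by (simp add: m_def)
  \<comment> \<open>The factor at \<open>i = k\<close> is zero.\<close>
  have small: "(\<Prod>i = 0..<m. k - i) = 0" if "k < m" for k
    using that by auto
  have fact_eq: "(\<Prod>i = 0..<m. k + m - i) * fact k = fact (k + m)" for k
  \<comment> \<open>The new last factor is \<open>k + 1\<close>; it turns \<open>fact k\<close> into
    \<open>fact (Suc k)\<close>, hence the generalisation over \<open>k\<close>.\<close>
  proof (induction m arbitrary: k)
    case (Suc m)
    then show ?case
      using Suc.IH[of "Suc k"] by (simp add: algebra_simps)
  qed simp
  have "real (\<Prod>i = 0..<m. k + m - i) / fact (k + m) = inverse (fact k)" for k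
  proof -
    have "real (\<Prod>i = 0..<m. k + m - i) * fact k = fact (k + m)"
      by (metis fact_eq of_nat_fact of_nat_mult)
    then show ?thesis
      by (simp add: field_simps)
  qed
  moreover have "(\<lambda>k. inverse (fact k)) sums exp (1 :: real)"
    using exp_converges[of "1 :: real"] by simp
  ultimately have "(\<lambda>k. real (\<Prod>i = 0..<m. k + m - i) / fact (k + m)) sums exp 1"
    by simp
  then have "(\<lambda>k. real (\<Prod>i = 0..<m. k - i) / fact k) sums exp 1"
    by (subst (asm) sums_zero_iff_shift) (use small in auto)
  then show ?thesis
    by (simp only: card)
qed

theorem dobinski: "(\<lambda>k. real k ^ n / fact k) sums (exp 1 * real (bell n))"
proof -
  have "(\<lambda>k. \<Sum>P | partition_on {..<n} P. real (card {g \<in> P \<rightarrow>\<^sub>E {..<k}. inj_on g P}) / fact k)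
      sums (\<Sum>P | partition_on {..<n} P. exp 1)"
    by (intro sums_sum sums_card_injections) (use finite_elements in auto)
  moreover have "(\<Sum>P | partition_on {..<n} P. real (card {g \<in> P \<rightarrow>\<^sub>E {..<k}. inj_on g P}) / fact k)
      = real k ^ n / fact k" for k
    using card_funcset_eq_sum_partitions[of "{..<n}" "{..<k}"]
    by (simp flip: sum_divide_distrib of_nat_sum of_nat_power)
  ultimately show ?thesis
    by (simp add: bell_def mult.commute)
qed

lemma dobinski_binomial:
  "(\<lambda>k. real k ^ m * (real k + 1) ^ p / fact k)
     sums (exp 1 * real (\<Sum>i = 0..p. (p choose i) * bell (m + i)))"
proof -
  have "(\<lambda>k. \<Sum>i = 0..p. real (p choose i) * (real k ^ (m + i) / fact k))
      sums (\<Sum>i = 0..p. real (p choose i) * (exp 1 * real (bell (m + i))))"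
    by (intro sums_sum sums_mult dobinski)
  moreover have "(\<Sum>i = 0..p. real (p choose i) * (real k ^ (m + i) / fact k))
      = real k ^ m * (real k + 1) ^ p / fact k" for k
    by (simp add: binomial_ring atLeast0AtMost sum_distrib_left sum_divide_distrib power_add mult_ac)
  ultimately show ?thesis
    by (simp add: sum_distrib_left mult_ac)
qed

text \<open>Up to scaling, a * c - b^2 is a variance: the series of u k * (a * k - b)^2 sums to a *
  (a * c - b^2). As a > 0, its square vanishes for at most one k, so two positive weights force
  strictness.\<close>

lemma sums_Cauchy_Schwarz_strict:
  fixes u :: "nat \<Rightarrow> real"
  assumes a: "u sums a" and b: "(\<lambda>k. u k * real k) sums b" and c: "(\<lambda>k. u k * real k ^ 2) sums c"
    and nonneg: "\<And>k. 0 \<le> u k" and pos: "0 < u i" "0 < u j" "i \<noteq> j"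
  shows "b ^ 2 < a * c"
proof -
  have a_pos: "0 < a"
    using suminf_pos2[of u i] a nonneg pos(1) by (simp add: sums_iff)
  have "(\<lambda>k. a\<^sup>2 * (u k * real k ^ 2) - 2 * a * b * (u k * real k) + b\<^sup>2 * u k)
      sums (a\<^sup>2 * c - 2 * a * b * b + b\<^sup>2 * a)"
    by (intro sums_add sums_diff sums_mult a b c)
  moreover have "a\<^sup>2 * (u k * real k ^ 2) - 2 * a * b * (u k * real k) + b\<^sup>2 * u k
      = u k * (a * real k - b)\<^sup>2" for k
    by (simp add: power2_eq_square algebra_simps)
  moreover have "a\<^sup>2 * c - 2 * a * b * b + b\<^sup>2 * a = a * (a * c - b\<^sup>2)"
    by (simp add: power2_eq_square algebra_simps)
  ultimately have sums: "(\<lambda>k. u k * (a * real k - b)\<^sup>2) sums (a * (a * c - b\<^sup>2))"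
    by simp
  have "a * real i \<noteq> b \<or> a * real j \<noteq> b"
    using a_pos pos(3) by auto
  then obtain l where "0 < u l" "a * real l - b \<noteq> 0"
    using pos by auto
  then have "0 < u l * (a * real l - b)\<^sup>2"
    by simp
  then have "0 < a * (a * c - b\<^sup>2)"
    using suminf_pos2[of "\<lambda>k. u k * (a * real k - b)\<^sup>2" l] sums nonneg by (simp add: sums_iff)
  then show ?thesis
    using a_pos by (simp add: zero_less_mult_iff)
qed

theorem corollary9:
  fixes n p :: nat
  assumes "n \<ge> 1"
  shows "(\<Sum>i = 0..p + 1. (p + 1 choose i) * bell (n + i)) * (\<Sum>i = 0..p. (p choose i) * bell (n + i))
    < (\<Sum>i = 0..p + 1. (p + 1 choose i) * bell (n + i - 1)) * (\<Sum>i = 0..p. (p choose i) * bell (n + i + 1))"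
proof -
  \<comment> \<open>Writing \<open>n = m + 1\<close> removes the truncated subtraction in
    \<open>n + i - 1\<close>.\<close>
  obtain m where n: "n = m + 1"
    using assms by (metis add.commute le_Suc_ex)
  define T where "T m p = (\<Sum>i = 0..p. (p choose i) * bell (m + i))" for m p
  define u where "u k = real k ^ m * (real k + 1) ^ p / fact k" for k
  have dob: "(\<lambda>k. real k ^ m * (real k + 1) ^ p / fact k) sums (exp 1 * real (T m p))" for m p
    unfolding T_def by (rule dobinski_binomial)
  \<comment> \<open>Split one factor k + 1 off (k + 1)^(p + 1) in the series; uniqueness of sums
    replaces Pascal's rule.\<close>
  have T_Suc: "T m (p + 1) = T (m + 1) p + T m p" for m p
  proof -
    have "exp 1 * real (T m (p + 1)) = exp 1 * real (T (m + 1) p) + exp 1 * real (T m p)"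
      using sums_add[OF dob[of "m + 1" p] dob[of m p]]
      by (intro sums_unique2[OF dob]) (simp add: algebra_simps add_divide_distrib)
    then have "real (T m (p + 1)) = real (T (m + 1) p + T m p)"
      by (simp flip: distrib_left)
    then show ?thesis
      by (simp only: of_nat_eq_iff)
  qed
  have "(exp 1 * real (T (m + 1) p))\<^sup>2 < (exp 1 * real (T m p)) * (exp 1 * real (T (m + 2) p))"
  \<comment> \<open>Index 0 is avoided because its weight vanishes when
    \<open>m > 0\<close>.\<close>
  proof (rule sums_Cauchy_Schwarz_strict[where u = u and i = 1 and j = 2])
    show "u sums (exp 1 * real (T m p))"
      unfolding u_def by (rule dob)
    show "(\<lambda>k. u k * real k) sums (exp 1 * real (T (m + 1) p))"
      using dob[of "m + 1" p] by (simp add: u_def mult_ac)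
    show "(\<lambda>k. u k * real k ^ 2) sums (exp 1 * real (T (m + 2) p))"
      using dob[of "m + 2" p] by (simp add: u_def mult_ac power2_eq_square)
  qed (auto simp: u_def)
  then have "(exp 1)\<^sup>2 * (real (T (m + 1) p))\<^sup>2 < (exp 1)\<^sup>2 * (real (T m p) * real (T (m + 2) p))"
    by (simp add: power2_eq_square mult_ac)
  then have "real ((T (m + 1) p)\<^sup>2) < real (T m p * T (m + 2) p)"
    by simp
  then have "(T (m + 1) p)\<^sup>2 < T m p * T (m + 2) p"
    by (simp only: of_nat_less_iff)
  \<comment> \<open>After \<open>T_Suc\<close>, both sides contain the product
    \<open>T (m + 1) p * T (m + 2) p\<close>, which cancels.\<close>
  then have "T (m + 1) (p + 1) * T (m + 1) p < T m (p + 1) * T (m + 2) p"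
    by (simp only: T_Suc) (simp add: power2_eq_square algebra_simps)
  then show ?thesis
    by (simp add: n T_def)
qed

end
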